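(* Let $\mathcal H$ be a complex Hilbert space and let $T\in\mathcal B(\mathcal H)$ be an analytic norm-increasing operator with spectrum contained in the closed unit disc in $\mathbb C$. Let $T'=T(T^*T)^{-1}$ be the Cauchy dual of $T$. If $\mathcal M$ is a nonzero (closed) invariant subspace of $T'$, then for any $\lambda\in\sigma_{ap}(T'|_{\mathcal M})$ there exists a Weyl sequence in $\mathcal M$ for both $(\lambda,T)$ and $(\lambda,T')$.
   Context: $\mathcal B(\mathcal H)$ is the algebra of bounded linear operators on $\mathcal H$. $T$ is analytic if $\bigcap_{n\geq0}T^n\mathcal H=\{0\}$, and norm-increasing if $T^*T\geq I$. $\sigma_{ap}(T'|_{\mathcal M})$ is the approximate point spectrum of $T'|_{\mathcal M}$ as an operator on $\mathcal M$. A Weyl sequence for $(\lambda,S)$, with $\lambda\in\mathbb C$ and $S\in\mathcal B(\mathcal H)$, is a weakly null sequence $\{u_n\}_{n\geq1}$ of unit vectors such that $(S-\lambda)u_n\to0$ as $n\to\infty$; "a Weyl sequence in $\mathcal M$ for both" means a single sequence contained in $\mathcal M$ that is a Weyl sequence for both pairs. *)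

theory Defs
  imports "HOL-Analysis.Analysis"
begin

class scaleC = scaleR +
  fixes scaleC :: "complex \<Rightarrow> 'a \<Rightarrow> 'a" (infixr "*\<^sub>C" 75)
  assumes scaleR_scaleC: "scaleR r x = complex_of_real r *\<^sub>C x"

class complex_vector = scaleC + ab_group_add +
  assumes scaleC_add_right: "a *\<^sub>C (x + y) = a *\<^sub>C x + a *\<^sub>C y"
    and scaleC_add_left: "(a + b) *\<^sub>C x = a *\<^sub>C x + b *\<^sub>C x"
    and scaleC_scaleC: "a *\<^sub>C (b *\<^sub>C x) = (a * b) *\<^sub>C x"
    and scaleC_one: "1 *\<^sub>C x = x"

text \<open>
  The complex inner product is linear in its first argument. The underlying real inner product is
  its real part, so that the norm inherited from \<^class>\<open>real_inner\<close> is
  the square root of the inner product of a vector with itself; positive definiteness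
  is inherited from \<^class>\<open>real_inner\<close> as well.
\<close>

class complex_inner = complex_vector + real_inner +
  fixes cinner :: "'a \<Rightarrow> 'a \<Rightarrow> complex"
  assumes cinner_commute: "cinner x y = cnj (cinner y x)"
    and cinner_add_left: "cinner (x + y) z = cinner x z + cinner y z"
    and cinner_scaleC_left: "cinner (a *\<^sub>C x) y = a * cinner x y"
    and inner_eq_Re_cinner: "inner x y = Re (cinner x y)"

class chilbert_space = complex_inner + complete_space

definition bounded_clinear :: "('a::chilbert_space \<Rightarrow> 'a) \<Rightarrow> bool" where
  "bounded_clinear S \<longleftrightarrow> bounded_linear S \<and> (\<forall>c x. S (c *\<^sub>C x) = c *\<^sub>C S x)"

definition csubspace :: "'a::chilbert_space set \<Rightarrow> bool" where
  "csubspace M \<longleftrightarrow> subspace M \<and> (\<forall>c. \<forall>x\<in>M. c *\<^sub>C x \<in> M)"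

text \<open>Meaningful for bounded operators, where existence is the Riesz representation theorem.\<close>

definition cadjoint :: "('a::chilbert_space \<Rightarrow> 'a) \<Rightarrow> 'a \<Rightarrow> 'a" where
  "cadjoint S = (THE R. \<forall>x y. cinner (S x) y = cinner x (R y))"

definition op_le :: "('a::chilbert_space \<Rightarrow> 'a) \<Rightarrow> ('a \<Rightarrow> 'a) \<Rightarrow> bool" where
  "op_le R S \<longleftrightarrow> (\<forall>x. cinner (S x - R x) x \<in> \<real>\<^sub>\<ge>\<^sub>0)"

definition norm_increasing :: "('a::chilbert_space \<Rightarrow> 'a) \<Rightarrow> bool" where
  "norm_increasing T \<longleftrightarrow> op_le id (cadjoint T \<circ> T)"

definition analytic_op :: "('a::chilbert_space \<Rightarrow> 'a) \<Rightarrow> bool" where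
  "analytic_op T \<longleftrightarrow> (\<Inter>n. range (T ^^ n)) = {0}"

definition op_spectrum :: "('a::chilbert_space \<Rightarrow> 'a) \<Rightarrow> complex set" where
  "op_spectrum S = {\<mu>. \<not> (\<exists>R. bounded_clinear R \<and>
     R \<circ> (\<lambda>x. S x - \<mu> *\<^sub>C x) = id \<and> (\<lambda>x. S x - \<mu> *\<^sub>C x) \<circ> R = id)}"

text \<open>\<^const>\<open>inv\<close> is the operator inverse whenever its argument is bijective, which is the case
  here when \<open>T\<close> is bounded and \<^const>\<open>norm_increasing\<close>.\<close>

definition cauchy_dual :: "('a::chilbert_space \<Rightarrow> 'a) \<Rightarrow> 'a \<Rightarrow> 'a" where
  "cauchy_dual T = T \<circ> inv (cadjoint T \<circ> T)"

text \<open>The approximate point spectrum of the restriction of \<open>S\<close> to an invariant subspace \<open>M\<close>,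
  as an operator on \<open>M\<close>.\<close>

definition ap_spectrum_on :: "'a::chilbert_space set \<Rightarrow> ('a \<Rightarrow> 'a) \<Rightarrow> complex set" where
  "ap_spectrum_on M S = {\<mu>. \<exists>u::nat \<Rightarrow> 'a. (\<forall>n. u n \<in> M \<and> norm (u n) = 1) \<and>
     (\<lambda>n. S (u n) - \<mu> *\<^sub>C u n) \<longlonglongrightarrow> 0}"

definition weakly_null :: "(nat \<Rightarrow> 'a::chilbert_space) \<Rightarrow> bool" where
  "weakly_null u \<longleftrightarrow> (\<forall>y. (\<lambda>n. cinner (u n) y) \<longlonglongrightarrow> 0)"

definition weyl_sequence :: "complex \<Rightarrow> ('a::chilbert_space \<Rightarrow> 'a) \<Rightarrow> (nat \<Rightarrow> 'a) \<Rightarrow> bool" where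
  "weyl_sequence \<mu> S u \<longleftrightarrow> weakly_null u \<and> (\<forall>n. norm (u n) = 1) \<and>
     (\<lambda>n. S (u n) - \<mu> *\<^sub>C u n) \<longlonglongrightarrow> 0"

end

theory Submission
  imports Defs
begin

text \<open>
  The given approximate eigenvectors \<open>u n\<close> of \<open>T'\<close> in \<open>M\<close> already form the required
  sequence. This rests on three facts.

  First, \<open>\<bar>\<mu>\<bar> = 1\<close>. Writing \<open>x = T\<^sup>*T b\<close>, so that \<open>T' x = T b\<close>, one finds
  \<open>\<parallel>b\<parallel> \<le> \<parallel>T b\<parallel> \<le> \<parallel>x\<parallel>\<close>; thus \<open>T'\<close> is a contraction and \<open>\<bar>\<mu>\<bar> \<le> 1\<close>. Conversely
  \<open>T\<^sup>*T' = I\<close> gives \<open>T\<^sup>*(T' - \<mu>) = I - \<mu> T\<^sup>*\<close>, and for \<open>\<bar>\<mu>\<bar> < 1\<close> the right-hand side is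
  bounded below, because the spectrum of \<open>T\<close> lies in the closed unit disc
  (\<open>approx_eigenvalue_cauchy_dual_ge_1\<close>).

  Second, \<open>\<parallel>T' (u n)\<parallel> \<longlonglongrightarrow> 1 = \<parallel>u n\<parallel>\<close> forces \<open>(T\<^sup>*T)\<^sup>-\<^sup>1 (u n) - u n \<longlonglongrightarrow> 0\<close>
  (the estimate \<open>cauchy_dual_defect\<close>), and applying \<open>T\<close> gives \<open>T' (u n) - T (u n) \<longlonglongrightarrow> 0\<close>.
  Hence \<open>u\<close> consists of approximate eigenvectors of \<open>T\<close> as well.

  Third, an analytic operator has no nonzero eigenvalue, so \<open>T - \<mu>\<close> is injective and the range of
  its adjoint is dense. As \<open>u n\<close> is asymptotically orthogonal to that range and bounded, it is
  weakly null (\<open>weakly_null_if_approx_eigenvectors\<close>).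
\<close>

section \<open>Orthogonal complements and Riesz representation\<close>

text \<open>A minimizing sequence for the distance from a point \<open>x\<close> to \<open>S\<close> is Cauchy by the parallelogram
  law, and the vector from its limit to \<open>x\<close> is orthogonal to \<open>S\<close>.\<close>

lemma exists_orthogonal_to_proper_closed_subspace:
  fixes S :: "'a::{real_inner,complete_space} set"
  assumes S: "subspace S" "closed S" "S \<noteq> UNIV"
  obtains z where "z \<noteq> 0" "\<And>s. s \<in> S \<Longrightarrow> inner z s = 0"
proof -
  obtain x where x: "x \<notin> S" using S(3) by blast
  define D where "D = (INF s\<in>S. (norm (x - s))\<^sup>2)"
  have bdd: "bdd_below ((\<lambda>s. (norm (x - s))\<^sup>2) ` S)"
    by (rule bdd_belowI2[of _ 0]) simp
  have ne: "S \<noteq> {}" using subspace_0[OF S(1)] by blast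
  have D_le: "D \<le> (norm (x - s))\<^sup>2" if "s \<in> S" for s
    unfolding D_def by (rule cINF_lower[OF bdd that])
  have "\<exists>s\<in>S. (norm (x - s))\<^sup>2 < D + 1 / Suc n" for n
  proof -
    have "D < D + 1 / Suc n" by simp
    then show ?thesis unfolding D_def using cINF_less_iff[OF ne bdd] by blast
  qed
  then obtain s where s: "\<And>n. s n \<in> S" "\<And>n. (norm (x - s n))\<^sup>2 < D + 1 / Suc n" by metis
  have close: "(norm (s m - s n))\<^sup>2 \<le> 2 * (1 / Suc m + 1 / Suc n)" for m n
  proof -
    have mid: "(1/2) *\<^sub>R (s m + s n) \<in> S"
      using S(1) s(1) by (simp add: subspace_add subspace_scale)
    have "(norm (s m - s n))\<^sup>2 =
        2 * (norm (x - s m))\<^sup>2 + 2 * (norm (x - s n))\<^sup>2 - 4 * (norm (x - (1/2) *\<^sub>R (s m + s n)))\<^sup>2"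
      unfolding power2_norm_eq_inner
      by (simp add: inner_diff_left inner_diff_right inner_add_left inner_add_right inner_commute
          algebra_simps)
    then show ?thesis using D_le[OF mid] s(2)[of m] s(2)[of n] by (simp add: algebra_simps)
  qed
  have "Cauchy s"
  proof (rule metric_CauchyI)
    fix e :: real assume e: "e > 0"
    obtain N where N: "1 / Suc N < e\<^sup>2 / 4"
      using reals_Archimedean[of "e\<^sup>2 / 4"] e by (auto simp: inverse_eq_divide)
    have "dist (s m) (s n) < e" if mn: "m \<ge> N" "n \<ge> N" for m n
    proof -
      have "1 / real (Suc m) \<le> 1 / Suc N" "1 / real (Suc n) \<le> 1 / Suc N"
        using mn by (auto intro!: divide_left_mono)
      then have "(norm (s m - s n))\<^sup>2 < e\<^sup>2" using close[of m n] N by argo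
      then show ?thesis using e by (simp add: dist_norm power_less_imp_less_base)
    qed
    then show "\<exists>N. \<forall>m\<ge>N. \<forall>n\<ge>N. dist (s m) (s n) < e" by blast
  qed
  then obtain p where p: "s \<longlonglongrightarrow> p" using Cauchy_convergent_iff convergent_def by blast
  have pS: "p \<in> S" using closed_sequentially[OF S(2) s(1) p] .
  have "(norm (x - p))\<^sup>2 \<le> D + 0"
  proof (rule LIMSEQ_le)
    show "(\<lambda>n. (norm (x - s n))\<^sup>2) \<longlonglongrightarrow> (norm (x - p))\<^sup>2" by (intro tendsto_intros p)
    show "(\<lambda>n. D + 1 / Suc n) \<longlonglongrightarrow> D + 0"
      using LIMSEQ_inverse_real_of_nat by (intro tendsto_intros) (simp add: inverse_eq_divide)
    show "\<exists>N. \<forall>n\<ge>N. (norm (x - s n))\<^sup>2 \<le> D + 1 / Suc n" using s(2) less_imp_le by blast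
  qed
  then have min: "(norm (x - p))\<^sup>2 \<le> (norm (x - t))\<^sup>2" if "t \<in> S" for t
    using D_le[OF that] by linarith
  have "inner (x - p) t = 0" if t: "t \<in> S" for t
  proof (cases "t = 0")
    case False
    define c where "c = inner (x - p) t / inner t t"
    have "p + c *\<^sub>R t \<in> S" using S(1) pS t by (simp add: subspace_add subspace_scale)
    then have "inner (x - p) (x - p) \<le> inner ((x - p) - c *\<^sub>R t) ((x - p) - c *\<^sub>R t)"
      using min unfolding power2_norm_eq_inner by (metis diff_diff_eq)
    also have "\<dots> = inner (x - p) (x - p) - 2 * c * inner (x - p) t + c * c * inner t t"
      by (simp add: inner_diff_left inner_diff_right inner_commute algebra_simps)
    also have "\<dots> = inner (x - p) (x - p) - (inner (x - p) t)\<^sup>2 / inner t t"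
      using False unfolding c_def by (simp add: power2_eq_square)
    finally have "(inner (x - p) t)\<^sup>2 / inner t t \<le> 0" by simp
    moreover have "inner t t > 0" using False by simp
    ultimately have "(inner (x - p) t)\<^sup>2 \<le> 0" by (simp add: divide_le_0_iff)
    then show ?thesis by simp
  qed simp
  moreover have "x - p \<noteq> 0" using x pS by auto
  ultimately show thesis using that by blast
qed

text \<open>A functional is determined up to a factor by its kernel, so the representing vector is a multiple
  of any nonzero vector orthogonal to the kernel.\<close>

lemma riesz_representation:
  fixes f :: "'a::{real_inner,complete_space} \<Rightarrow> real"
  assumes "bounded_linear f"
  obtains r where "\<And>x. f x = inner x r"
proof -
  interpret f: bounded_linear f by fact
  let ?K = "{x. f x = 0}"
  show thesis
  proof (cases "?K = UNIV")
    case True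
    then show ?thesis using that[of 0] by auto
  next
    case False
    have "subspace ?K" by (simp add: subspace_def f.add f.scaleR f.zero)
    moreover have "closed ?K"
      by (intro closed_Collect_eq continuous_intros linear_continuous_on assms)
    ultimately obtain z where z: "z \<noteq> 0" "\<And>s. s \<in> ?K \<Longrightarrow> inner z s = 0"
      using exists_orthogonal_to_proper_closed_subspace False by blast
    have fz: "f z \<noteq> 0" using z by fastforce
    show ?thesis
    proof (rule that[of "(f z / inner z z) *\<^sub>R z"])
      fix x
      have "x - (f x / f z) *\<^sub>R z \<in> ?K" using fz by (simp add: f.diff f.scaleR)
      from z(2)[OF this] have "inner x z = f x / f z * inner z z"
        by (simp add: inner_diff_right inner_commute)
      then show "f x = inner x ((f z / inner z z) *\<^sub>R z)" using fz z(1) by simp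
    qed
  qed
qed

section \<open>Complex structure and adjoints\<close>

lemma cinner_scaleC_right: "cinner x (a *\<^sub>C y) = cnj a * cinner x y"
  by (metis cinner_commute cinner_scaleC_left complex_cnj_mult)

lemma norm_scaleC: "norm (a *\<^sub>C x) = cmod a * norm (x::'a::complex_inner)"
proof -
  have "cinner (a *\<^sub>C x) (a *\<^sub>C x) = of_real ((cmod a)\<^sup>2) * cinner x x"
    by (simp add: cinner_scaleC_left cinner_scaleC_right complex_norm_square flip: mult.assoc
        del: of_real_power)
  then have "(norm (a *\<^sub>C x))\<^sup>2 = (cmod a * norm x)\<^sup>2"
    by (simp add: power2_norm_eq_inner inner_eq_Re_cinner power_mult_distrib del: of_real_power)
  then show ?thesis by (simp add: power2_eq_iff_nonneg)
qed

text \<open>The complex inner product is determined by the real one; this reduces complex orthogonality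
  and weak convergence to the real Hilbert space.\<close>

lemma cinner_eq_Complex: "cinner x y = Complex (inner x y) (inner x (\<i> *\<^sub>C y))"
  by (simp add: complex_eq_iff inner_eq_Re_cinner cinner_scaleC_right)

lemma inner_scaleC_left: "inner (a *\<^sub>C x) y = inner x (cnj a *\<^sub>C (y::'a::complex_inner))"
  by (simp add: inner_eq_Re_cinner cinner_scaleC_left cinner_scaleC_right)

text \<open>This also shows that the adjoint exists. The adjoint with respect to the real inner product is
  already the complex one: complex linearity moves the factor \<open>\<i>\<close>, which carries the imaginary
  part, across the inner product.\<close>

lemma cinner_cadjoint:
  fixes S :: "'a::chilbert_space \<Rightarrow> 'a"
  assumes "bounded_clinear S"
  shows "cinner (S x) y = cinner x (cadjoint S y)"
proof -
  have S: "bounded_linear S" "\<And>c x. S (c *\<^sub>C x) = c *\<^sub>C S x"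
    using assms by (auto simp: bounded_clinear_def)
  have "\<exists>r. \<forall>x. inner (S x) y = inner x r" for y
    using riesz_representation[OF bounded_linear_compose[OF bounded_linear_inner_left S(1)], of y]
    by metis
  then obtain R where R: "\<And>x y. inner (S x) y = inner x (R y)" by metis
  have cR: "cinner (S x) y = cinner x (R y)" for x y
  proof -
    have "inner (S x) (\<i> *\<^sub>C y) = inner (S (cnj \<i> *\<^sub>C x)) y"
      unfolding S(2) inner_scaleC_left by simp
    also have "\<dots> = inner x (\<i> *\<^sub>C R y)" unfolding R inner_scaleC_left by simp
    finally show ?thesis unfolding cinner_eq_Complex[of _ y] cinner_eq_Complex[of _ "R y"] R by simp
  qed
  have "cadjoint S = R"
    unfolding cadjoint_def
  proof (rule the_equality)
    show "\<forall>x y. cinner (S x) y = cinner x (R y)" using cR by blast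
    fix Q assume "\<forall>x y. cinner (S x) y = cinner x (Q y)"
    then have "inner x (Q y) = inner x (R y)" for x y using cR by (metis inner_eq_Re_cinner)
    then show "Q = R" using vector_eq_ldot by blast
  qed
  then show ?thesis using cR by simp
qed

lemma inner_cadjoint:
  fixes S :: "'a::chilbert_space \<Rightarrow> 'a"
  assumes "bounded_clinear S"
  shows "inner (S x) y = inner x (cadjoint S y)"
  by (simp add: inner_eq_Re_cinner cinner_cadjoint[OF assms])

lemma bounded_linear_cadjoint:
  fixes S :: "'a::chilbert_space \<Rightarrow> 'a"
  assumes S: "bounded_clinear S"
  shows "bounded_linear (cadjoint S)"
proof -
  have "bounded_linear S" using S by (simp add: bounded_clinear_def)
  then obtain K where K: "\<And>x. norm (S x) \<le> norm x * K" using bounded_linear.bounded by blast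
  note adj = inner_cadjoint[OF S, symmetric]
  show ?thesis
  proof (rule bounded_linear_intro)
    fix x y
    show "cadjoint S (x + y) = cadjoint S x + cadjoint S y"
      by (rule iffD1[OF vector_eq_ldot]) (simp add: inner_add_right adj)
    show "cadjoint S (r *\<^sub>R x) = r *\<^sub>R cadjoint S x" for r
      by (rule iffD1[OF vector_eq_ldot]) (simp add: adj)
    have "(norm (cadjoint S x))\<^sup>2 = inner (S (cadjoint S x)) x"
      by (simp add: power2_norm_eq_inner adj)
    also have "\<dots> \<le> norm (cadjoint S x) * K * norm x"
      using norm_cauchy_schwarz[of "S (cadjoint S x)" x] mult_right_mono[OF K, of "norm x"]
      by (meson norm_ge_zero order_trans)
    finally have "norm (cadjoint S x) * norm (cadjoint S x) \<le> norm (cadjoint S x) * (norm x * K)"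
      by (simp add: power2_eq_square mult_ac)
    then show "norm (cadjoint S x) \<le> norm x * K"
    proof (cases "cadjoint S x = 0")
      case True
      then show ?thesis using K[of x] by (metis norm_ge_zero norm_zero order_trans)
    qed simp
  qed
qed

section \<open>The Cauchy dual of a norm-increasing operator\<close>

lemma norm_increasing_norm_le:
  fixes T :: "'a::chilbert_space \<Rightarrow> 'a"
  assumes T: "bounded_clinear T" and "norm_increasing T"
  shows "norm x \<le> norm (T x)"
proof -
  have "cinner (cadjoint T (T x) - x) x \<in> \<real>\<^sub>\<ge>\<^sub>0"
    using assms(2) by (simp add: norm_increasing_def op_le_def)
  then have "inner (cadjoint T (T x) - x) x \<ge> 0"
    by (simp add: complex_nonneg_Reals_iff inner_eq_Re_cinner)
  then have "inner x x \<le> inner (T x) (T x)"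
    by (simp add: inner_diff_left inner_diff_right inner_cadjoint[OF T] inner_commute)
  then show ?thesis by (simp add: norm_le)
qed

text \<open>Lax-Milgram for \<open>T\<^sup>*T\<close>: it is bounded below, hence injective with closed range, and a vector
  orthogonal to the range is orthogonal to its own image, hence zero.\<close>

lemma bij_cadjoint_comp:
  fixes T :: "'a::chilbert_space \<Rightarrow> 'a"
  assumes T: "bounded_clinear T" "norm_increasing T"
  shows "bij (cadjoint T \<circ> T)"
proof -
  let ?A = "cadjoint T \<circ> T"
  have linA: "bounded_linear ?A"
    unfolding comp_def using T(1) bounded_linear_cadjoint bounded_linear_compose
    by (auto simp: bounded_clinear_def)
  interpret A: bounded_linear ?A by fact
  have coercive: "(norm x)\<^sup>2 \<le> inner x (?A x)" for x
    using norm_increasing_norm_le[OF T, of x]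
    by (simp flip: inner_cadjoint[OF T(1)] add: norm_le power2_norm_eq_inner)
  have below: "norm x \<le> norm (?A x)" for x
  proof -
    have "norm x * norm x \<le> norm x * norm (?A x)"
      using coercive[of x] norm_cauchy_schwarz[of x "?A x"] by (simp add: power2_eq_square)
    then show ?thesis by (cases "x = 0") auto
  qed
  have "inj ?A" 
    using below linear_injective_0[OF A.linear_axioms] by (metis norm_le_zero_iff norm_zero)
  moreover have "range ?A = UNIV"
  proof (rule ccontr)
    assume "range ?A \<noteq> UNIV"
    moreover have "complete (range ?A)"
      by (rule complete_isometric_image[of 1]) (use below linA in \<open>auto simp: complete_UNIV\<close>)
    then have "closed (range ?A)" by (rule complete_imp_closed)
    moreover have "subspace (range ?A)"
      using A.linear_axioms linear_subspace_image subspace_UNIV by blast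
    ultimately obtain z where "z \<noteq> 0" "\<And>s. s \<in> range ?A \<Longrightarrow> inner z s = 0"
      using exists_orthogonal_to_proper_closed_subspace by blast
    then show False using coercive[of z] by simp
  qed
  ultimately show ?thesis by (simp add: bij_def)
qed

lemma cadjoint_cauchy_dual:
  fixes T :: "'a::chilbert_space \<Rightarrow> 'a"
  assumes "bounded_clinear T" "norm_increasing T"
  shows "cadjoint T (cauchy_dual T x) = x"
  using surj_f_inv_f[OF bij_is_surj[OF bij_cadjoint_comp[OF assms]], of x]
  by (simp add: cauchy_dual_def)

text \<open>With \<open>b = (T\<^sup>*T)\<^sup>-\<^sup>1 x\<close> the left-hand side is
  \<open>\<parallel>x\<parallel>\<^sup>2 - 2 \<parallel>T b\<parallel>\<^sup>2 + \<parallel>b\<parallel>\<^sup>2\<close>, and \<open>\<parallel>b\<parallel> \<le> \<parallel>T b\<parallel>\<close>. Thus \<open>T'\<close> nearly preserves the norm of a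
  vector only if \<open>(T\<^sup>*T)\<^sup>-\<^sup>1\<close> nearly fixes that vector.\<close>

lemma cauchy_dual_defect:
  fixes T :: "'a::chilbert_space \<Rightarrow> 'a"
  assumes T: "bounded_clinear T" "norm_increasing T"
  shows "(norm (inv (cadjoint T \<circ> T) x - x))\<^sup>2 \<le> (norm x)\<^sup>2 - (norm (cauchy_dual T x))\<^sup>2"
proof -
  define b where "b = inv (cadjoint T \<circ> T) x"
  have x: "x = cadjoint T (T b)"
    using cadjoint_cauchy_dual[OF T, of x] by (simp add: b_def cauchy_dual_def)
  have "inner b x = (norm (T b))\<^sup>2"
    by (simp add: x power2_norm_eq_inner flip: inner_cadjoint[OF T(1)])
  then have "(norm (b - x))\<^sup>2 = (norm b)\<^sup>2 - 2 * (norm (T b))\<^sup>2 + (norm x)\<^sup>2"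
    by (simp add: power2_norm_eq_inner inner_diff_left inner_diff_right inner_commute)
  moreover have "(norm b)\<^sup>2 \<le> (norm (T b))\<^sup>2"
    using norm_increasing_norm_le[OF T] by (simp add: power_mono)
  ultimately show ?thesis by (simp add: cauchy_dual_def b_def)
qed

lemma norm_cauchy_dual_le:
  fixes T :: "'a::chilbert_space \<Rightarrow> 'a"
  assumes "bounded_clinear T" "norm_increasing T"
  shows "norm (cauchy_dual T x) \<le> norm x"
proof (rule power2_le_imp_le)
  show "(norm (cauchy_dual T x))\<^sup>2 \<le> (norm x)\<^sup>2"
    using order_trans[OF zero_le_power2 cauchy_dual_defect[OF assms, of x]] by simp
qed simp

section \<open>Approximate eigenvectors\<close>

text \<open>If \<open>\<bar>\<mu>\<bar> < 1\<close>, then \<open>I - cnj \<mu> T\<close> has a bounded right inverse \<open>R\<close>, by the hypothesis on the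
  spectrum. Its adjoint \<open>I - \<mu> T\<^sup>*\<close> equals \<open>T\<^sup>*(T' - \<mu>)\<close> and so sends \<open>u\<close> to a null sequence \<open>w\<close>;
  but the inner product of \<open>w n\<close> with the bounded sequence \<open>R (u n)\<close> is always 1.\<close>

lemma approx_eigenvalue_cauchy_dual_ge_1:
  fixes T :: "'a::chilbert_space \<Rightarrow> 'a"
  assumes T: "bounded_clinear T" "norm_increasing T" "op_spectrum T \<subseteq> cball 0 1"
    and u: "\<And>n. norm (u n) = 1" "(\<lambda>n. cauchy_dual T (u n) - \<mu> *\<^sub>C u n) \<longlonglongrightarrow> 0"
  shows "1 \<le> cmod \<mu>"
proof (rule ccontr)
  assume small: "\<not> 1 \<le> cmod \<mu>"
  define w where "w n = cadjoint T (cauchy_dual T (u n) - \<mu> *\<^sub>C u n)" for n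
  interpret adj: bounded_linear "cadjoint T" by (rule bounded_linear_cadjoint[OF T(1)])
  have w0: "w \<longlonglongrightarrow> 0" unfolding w_def using adj.tendsto[OF u(2)] by (simp add: adj.zero)
  have w: "inner (w n) x = inner (u n) (x - cnj \<mu> *\<^sub>C T x)" for n x
  proof -
    have "inner (w n) x = inner (u n) x - inner (T x) (\<mu> *\<^sub>C u n)"
      by (simp add: w_def adj.diff cadjoint_cauchy_dual[OF T(1,2)] inner_diff_left
          inner_diff_right inner_cadjoint[OF T(1)] inner_commute)
    also have "inner (T x) (\<mu> *\<^sub>C u n) = inner (u n) (cnj \<mu> *\<^sub>C T x)"
      by (metis inner_commute inner_scaleC_left)
    finally show ?thesis by (simp add: inner_diff_right)
  qed
  obtain R K where R: "\<And>x. R x - cnj \<mu> *\<^sub>C T (R x) = x" "\<And>x. norm (R x) \<le> norm x * K"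
  proof (cases "\<mu> = 0")
    case True
    then show ?thesis using that[of id 1] by (simp flip: scaleR_scaleC[of 0, simplified])
  next
    case False
    let ?\<nu> = "1 / cnj \<mu>"
    have "?\<nu> \<notin> op_spectrum T" using T(3) small False by (auto simp: norm_divide divide_simps)
    then obtain Q where Q: "bounded_clinear Q" "(\<lambda>x. T x - ?\<nu> *\<^sub>C x) \<circ> Q = id"
      by (auto simp: op_spectrum_def)
    have Q': "T (Q y) - ?\<nu> *\<^sub>C Q y = y" for y using fun_cong[OF Q(2), of y] by simp
    \<comment> \<open>\<open>I - cnj \<mu> T = - cnj \<mu> (T - 1/cnj \<mu>)\<close>, so its right inverse is \<open>- 1/cnj \<mu>\<close> times \<open>Q\<close>\<close>
    have "?\<nu> *\<^sub>C Q (- x) - cnj \<mu> *\<^sub>C T (?\<nu> *\<^sub>C Q (- x)) = x" for x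
    proof -
      have "T (?\<nu> *\<^sub>C Q (- x)) = ?\<nu> *\<^sub>C T (Q (- x))" using T(1) by (simp add: bounded_clinear_def)
      then have "cnj \<mu> *\<^sub>C T (?\<nu> *\<^sub>C Q (- x)) = T (Q (- x))"
        using False by (simp add: scaleC_scaleC scaleC_one)
      then show ?thesis using Q'[of "- x"] by (simp add: algebra_simps)
    qed
    moreover obtain K where "\<And>x. norm (Q x) \<le> norm x * K"
      using Q(1) bounded_linear.bounded unfolding bounded_clinear_def by blast
    then have "norm (?\<nu> *\<^sub>C Q (- x)) \<le> norm x * (cmod ?\<nu> * K)" for x
      using mult_left_mono[of "norm (Q (- x))" "norm x * K" "cmod ?\<nu>"]
      unfolding norm_scaleC by (metis mult.left_commute norm_ge_zero norm_minus_cancel)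
    ultimately show ?thesis using that[of "\<lambda>x. ?\<nu> *\<^sub>C Q (- x)"] by blast
  qed
  have "1 \<le> norm (w n) * K" for n
  proof -
    have "1 = inner (w n) (R (u n))"
      using u(1)[of n] by (simp add: w R(1) flip: power2_norm_eq_inner)
    also have "\<dots> \<le> norm (w n) * norm (R (u n))" by (rule norm_cauchy_schwarz)
    also have "\<dots> \<le> norm (w n) * K"
      using R(2)[of "u n"] u(1)[of n] by (simp add: mult_left_mono)
    finally show ?thesis .
  qed
  moreover have "(\<lambda>n. norm (w n) * K) \<longlonglongrightarrow> 0"
    using tendsto_mult_left_zero[OF tendsto_norm_zero[OF w0]] .
  ultimately have "(1::real) \<le> 0" by (intro LIMSEQ_le_const) auto
  then show False by simp
qed

lemma norm_tendsto_of_approx_eigenvectors: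
  fixes S :: "'a::chilbert_space \<Rightarrow> 'a"
  assumes u: "\<And>n. norm (u n) = 1" "(\<lambda>n. S (u n) - \<mu> *\<^sub>C u n) \<longlonglongrightarrow> 0"
  shows "(\<lambda>n. norm (S (u n))) \<longlonglongrightarrow> cmod \<mu>"
proof (rule LIM_zero_cancel, rule Lim_null_comparison[OF _ tendsto_norm_zero[OF u(2)]])
  have "\<bar>norm (S (u n)) - cmod \<mu>\<bar> \<le> norm (S (u n) - \<mu> *\<^sub>C u n)" for n
    using norm_triangle_ineq3[of "S (u n)" "\<mu> *\<^sub>C u n"] u(1)[of n] by (simp add: norm_scaleC)
  then show "\<forall>\<^sub>F n in sequentially. norm (norm (S (u n)) - cmod \<mu>) \<le> norm (S (u n) - \<mu> *\<^sub>C u n)"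
    by simp
qed

text \<open>An eigenvector for \<open>\<mu> \<noteq> 0\<close> is the image under \<open>T ^^ n\<close> of its multiple by \<open>(1/\<mu>)\<^sup>n\<close>, so it lies
  in every range.\<close>

lemma analytic_op_no_eigenvector:
  fixes T :: "'a::chilbert_space \<Rightarrow> 'a"
  assumes T: "bounded_clinear T" "analytic_op T" and z: "T z = \<mu> *\<^sub>C z" "\<mu> \<noteq> 0"
  shows "z = 0"
proof -
  have "(T ^^ n) ((1 / \<mu>) ^ n *\<^sub>C z) = z" for n
  proof (induction n)
    case (Suc n)
    have "T ((1 / \<mu>) ^ Suc n *\<^sub>C z) = ((1 / \<mu>) ^ Suc n * \<mu>) *\<^sub>C z"
      using T(1) z(1) by (simp add: bounded_clinear_def scaleC_scaleC)
    also have "(1 / \<mu>) ^ Suc n * \<mu> = (1 / \<mu>) ^ n" using z(2) by simp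
    finally show ?case using Suc by (simp add: funpow_Suc_right del: funpow.simps power_Suc)
  qed (simp add: scaleC_one)
  then have "z \<in> (\<Inter>n. range (T ^^ n))" by (metis INT_I rangeI)
  then show ?thesis using T(2) unfolding analytic_op_def by blast
qed

text \<open>The vectors to which a bounded sequence is asymptotically orthogonal form a closed subspace.
  Here it contains the range of \<open>(S - \<mu>)\<^sup>*\<close>, whose orthogonal complement is the kernel of
  \<open>S - \<mu>\<close>.\<close>

lemma weakly_null_if_approx_eigenvectors:
  fixes S :: "'a::chilbert_space \<Rightarrow> 'a"
  assumes S: "bounded_clinear S" and ker: "\<And>z. S z = \<mu> *\<^sub>C z \<Longrightarrow> z = 0"
    and u: "\<And>n. norm (u n) = 1" "(\<lambda>n. S (u n) - \<mu> *\<^sub>C u n) \<longlonglongrightarrow> 0"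
  shows "weakly_null u"
proof -
  define W where "W = {y. (\<lambda>n. inner (u n) y) \<longlonglongrightarrow> 0}"
  have adj: "inner x (cadjoint S y - cnj \<mu> *\<^sub>C y) = inner (S x - \<mu> *\<^sub>C x) y" for x y
    by (simp add: inner_diff_left inner_diff_right inner_cadjoint[OF S] inner_scaleC_left)
  have "subspace W"
    unfolding subspace_def W_def
    by (auto simp: inner_add_right intro: tendsto_add_zero tendsto_mult_right_zero)
  moreover have "closed W"
  proof -
    have "y \<in> W" if y: "y \<in> closure W" for y
    proof -
      have "\<forall>\<^sub>F n in sequentially. \<bar>inner (u n) y\<bar> < e" if e: "e > 0" for e
      proof -
        obtain v where v: "v \<in> W" "dist v y < e / 2"
          using y e by (meson closure_approachable half_gt_zero)
        then have "\<forall>\<^sub>F n in sequentially. \<bar>inner (u n) v\<bar> < e / 2"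
          using e tendstoD[of "\<lambda>n. inner (u n) v" 0 sequentially "e / 2"] by (simp add: W_def)
        then show ?thesis
        proof eventually_elim
          case (elim n)
          have "\<bar>inner (u n) (y - v)\<bar> \<le> norm (y - v)"
            using Cauchy_Schwarz_ineq2[of "u n" "y - v"] u(1)[of n] by simp
          then show ?case using elim v(2)
            by (simp add: dist_norm norm_minus_commute inner_diff_right)
        qed
      qed
      then show ?thesis unfolding W_def by (auto intro!: tendstoI)
    qed
    then show ?thesis using closure_subset_eq by blast
  qed
  moreover have inW: "cadjoint S y - cnj \<mu> *\<^sub>C y \<in> W" for y
    
    using tendsto_inner[OF u(2) tendsto_const, of y] unfolding W_def mem_Collect_eq adj by simp
  moreover have "z = 0" if "\<And>s. s \<in> W \<Longrightarrow> inner z s = 0" for z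
  proof -
    have "inner (S z - \<mu> *\<^sub>C z) y = 0" for y using that[OF inW] by (simp add: adj)
    then have "S z - \<mu> *\<^sub>C z = 0" using inner_eq_zero_iff by blast
    then show ?thesis using ker by simp
  qed
  ultimately have "W = UNIV" using exists_orthogonal_to_proper_closed_subspace by blast
  then have W: "(\<lambda>n. inner (u n) y) \<longlonglongrightarrow> 0" for y by (auto simp: W_def)
  have "(\<lambda>n. cinner (u n) y) \<longlonglongrightarrow> 0" for y
    unfolding cinner_eq_Complex using tendsto_Complex[OF W[of y] W[of "\<i> *\<^sub>C y"]]
    by (simp flip: zero_complex.code)
  then show ?thesis by (simp add: weakly_null_def)
qed

theorem theorem5p3:
  fixes T :: "'a::chilbert_space \<Rightarrow> 'a" and M :: "'a set" and \<mu> :: complex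
  assumes "bounded_clinear T"
    and "analytic_op T"
    and "norm_increasing T"
    and "op_spectrum T \<subseteq> cball 0 1"
    and "csubspace M" and "closed M" and "M \<noteq> {0}"
    and "cauchy_dual T ` M \<subseteq> M"
    and "\<mu> \<in> ap_spectrum_on M (cauchy_dual T)"
  shows "\<exists>u::nat \<Rightarrow> 'a. range u \<subseteq> M \<and> weyl_sequence \<mu> T u \<and> weyl_sequence \<mu> (cauchy_dual T) u"
proof -
  note T = assms(1,3)
  let ?B = "inv (cadjoint T \<circ> T)"
  obtain u where u: "\<And>n. u n \<in> M" "\<And>n. norm (u n) = 1"
    "(\<lambda>n. cauchy_dual T (u n) - \<mu> *\<^sub>C u n) \<longlonglongrightarrow> 0"
    using assms(9) by (auto simp: ap_spectrum_on_def)
  note lim = norm_tendsto_of_approx_eigenvectors[OF u(2,3)]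
  have "cmod \<mu> \<le> 1"
    using norm_cauchy_dual_le[OF T] u(2) by (intro LIMSEQ_le_const2[OF lim]) metis
  with approx_eigenvalue_cauchy_dual_ge_1[OF T assms(4) u(2,3)] have \<mu>: "cmod \<mu> = 1" by simp
  have "(\<lambda>n. 1 - (norm (cauchy_dual T (u n)))\<^sup>2) \<longlonglongrightarrow> 1 - 1\<^sup>2"
    using lim unfolding \<mu> by (intro tendsto_intros)
  then have defect: "(\<lambda>n. 1 - (norm (cauchy_dual T (u n)))\<^sup>2) \<longlonglongrightarrow> 0" by simp
  have "norm ((norm (?B (u n) - u n))\<^sup>2) \<le> 1 - (norm (cauchy_dual T (u n)))\<^sup>2" for n
    using cauchy_dual_defect[OF T, of "u n"] u(2)[of n] by simp
  then have "(\<lambda>n. (norm (?B (u n) - u n))\<^sup>2) \<longlonglongrightarrow> 0"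
    by (intro Lim_null_comparison[OF always_eventually defect]) blast
  then have B: "(\<lambda>n. ?B (u n) - u n) \<longlonglongrightarrow> 0"
    by (simp add: tendsto_norm_zero_iff power_tendsto_0_iff)
  interpret T: bounded_linear T using T(1) by (simp add: bounded_clinear_def)
  have "(\<lambda>n. cauchy_dual T (u n) - \<mu> *\<^sub>C u n - T (?B (u n) - u n)) \<longlonglongrightarrow> 0 - T 0"
    by (intro tendsto_diff u(3) T.tendsto B)
  then have Tu: "(\<lambda>n. T (u n) - \<mu> *\<^sub>C u n) \<longlonglongrightarrow> 0"
    by (simp add: cauchy_dual_def T.diff T.zero algebra_simps)
  have "\<mu> \<noteq> 0" using \<mu> by auto
  then have "z = 0" if "T z = \<mu> *\<^sub>C z" for z
    using analytic_op_no_eigenvector[OF T(1) assms(2) that] by blast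
  then have "weakly_null u" using weakly_null_if_approx_eigenvectors[OF T(1) _ u(2) Tu] by blast
  then show ?thesis using u Tu by (auto simp: weyl_sequence_def intro!: exI[of _ u])
qed

end
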